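(* Suppose that $a,b > 0$. There exists a constant $K$ that depends on $a$ and $b$ but not on $n \in \mathbb{N}$ such that for every $n \in \mathbb{N}$ the following holds: if $\Pi$ is uniformly distributed on $\mathfrak{S}_n$ and $\eta \in \mathfrak{S}_n$ has at most $a$ fixed points and at most $b$ $2$-cycles, then the total variation distance between the distribution of the number of fixed points of the commutator $[\eta,\Pi]$ and a Poisson distribution with expected value $1$ is at most $\frac{K}{n}$.
   Context: $\mathbb{N} = \{1,2,\ldots\}$, and $\mathfrak{S}_n$ is the set (group) of permutations of $[n] := \{1,2,\ldots,n\}$. The commutator is $[\eta,\Pi] := \eta^{-1}\Pi^{-1}\eta\,\Pi$. The number of $2$-cycles of $\eta$ is the number of cycles of length $2$ in its cycle decomposition. The total variation distance between two probability distributions $P$ and $Q$ on the nonnegative integers is $d_{\mathrm{TV}}(P,Q) = \sup_{B} |P(B) - Q(B)|$, the supremum being over all sets $B$ of nonnegative integers. *)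

theory Defs
  imports
    "HOL-Probability.Probability"
    "HOL-Combinatorics.Permutations"
    "HOL-Combinatorics.Orbits"
begin

text \<open>A permutation in \<open>\<SS>\<^sub>n\<close> is a function \<open>p :: nat \<Rightarrow> nat\<close> with \<open>p permutes {1..n}\<close>; it is the
  identity outside \<open>{1..n}\<close>, so points outside \<open>{1..n}\<close> must not be counted as fixed points.\<close>

definition sym_perms :: "nat \<Rightarrow> (nat \<Rightarrow> nat) set" where
  "sym_perms n = {p. p permutes {1..n}}"

definition num_fixed_points :: "nat \<Rightarrow> (nat \<Rightarrow> nat) \<Rightarrow> nat" where
  "num_fixed_points n p = card {i \<in> {1..n}. p i = i}"

text \<open>A cycle is identified with its set of entries, i.e. with an orbit of \<open>p\<close> on \<open>{1..n}\<close>.\<close>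

definition num_cycles_of_length :: "nat \<Rightarrow> nat \<Rightarrow> (nat \<Rightarrow> nat) \<Rightarrow> nat" where
  "num_cycles_of_length k n p = card {C \<in> orbit p ` {1..n}. card C = k}"

text \<open>The product of two permutations is composition, the right factor being applied first.\<close>

definition commutator :: "('a \<Rightarrow> 'a) \<Rightarrow> ('a \<Rightarrow> 'a) \<Rightarrow> 'a \<Rightarrow> 'a" where
  "commutator \<eta> \<pi> = inv \<eta> \<circ> inv \<pi> \<circ> \<eta> \<circ> \<pi>"

definition tv_dist :: "nat pmf \<Rightarrow> nat pmf \<Rightarrow> real" where
  "tv_dist P Q = (SUP B. \<bar>measure_pmf.prob P B - measure_pmf.prob Q B\<bar>)"

end

theory Submission
  imports Defs
begin

text \<open>A point \<open>i\<close> is fixed by the commutator of \<open>\<eta>\<close> and \<open>\<pi>\<close> iff \<open>\<pi> (\<eta> i) = \<eta> (\<pi> i)\<close>; let \<open>W \<pi>\<close> be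
  the number of such points. By Stein's method for the Poisson distribution it suffices to
  compare the sum of \<open>W \<sigma> f (W \<sigma>)\<close> over all \<open>\<sigma>\<close> with that of \<open>f (W \<pi> + 1)\<close> over all \<open>\<pi>\<close>, for
  \<open>f\<close> bounded by 2. For \<open>i\<close> not fixed by \<open>\<eta>\<close>, the switching \<open>(\<sigma>, x) \<mapsto> \<sigma> \<circ> (i x)\<close> matches the pairs
  with \<open>\<sigma>\<close> commuting at \<open>i\<close> and \<open>x \<noteq> \<eta> i\<close> bijectively with the permutations \<open>\<pi>\<close> for which
  \<open>\<pi> (\<eta> i)\<close> is not fixed by \<open>\<eta>\<close>, and it lowers \<open>W\<close> by exactly 1 except for a proportion
  \<open>O(1/n)\<close> of the pairs. Fixed points and 2-cycles of \<open>\<eta>\<close> only enter the error terms.\<close>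

hide_const (open) Finite_Cartesian_Product.transpose

section \<open>The Stein equation for the Poisson distribution\<close>

text \<open>Dividing the recursion by \<open>fact k\<close> makes it telescope, which forces
  \<open>f (Suc k)\<close> to be \<open>fact k\<close> times the sum of \<open>h\<close> up to
  \<open>k\<close>. The value \<open>f 0\<close> is free, since it enters only with the factor
  0.\<close>

lemma stein_poisson_1:
  fixes B :: "nat set"
  obtains f :: "nat \<Rightarrow> real"
  where "\<And>k. \<bar>f k\<bar> \<le> 2"
    and "\<And>k. f (Suc k) - real k * f k = indicator B k - measure_pmf.prob (poisson_pmf 1) B"
proof -
  define p where "p = measure_pmf.prob (poisson_pmf 1) B"
  define h where "h m = (indicator B m - p) / fact m" for m :: nat
  define f where "f k = (case k of 0 \<Rightarrow> 0 | Suc j \<Rightarrow> fact j * (\<Sum>m\<le>j. h m))" for k :: nat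
  have p01: "0 \<le> p" "p \<le> 1" by (simp_all add: p_def)
  have h_le: "\<bar>h m\<bar> \<le> 1 / fact m" for m
    using p01 by (auto simp: h_def indicator_def divide_right_mono)
  have exp1: "(\<lambda>m. 1 / fact m :: real) sums exp 1"
    using exp_converges[of "1::real"] by (simp add: divide_inverse)
  have "(\<lambda>m. if m \<in> B then pmf (poisson_pmf 1) m else 0) sums p"
    unfolding p_def measure_pmf_conv_infsetsum
    by (rule sums_infsetsum_nat) (rule pmf_abs_summable)
  moreover have "(\<lambda>m. if m \<in> B then pmf (poisson_pmf 1) m else 0) =
      (\<lambda>m. indicator B m * pmf (poisson_pmf 1) m)"
    by (auto simp: fun_eq_iff)
  ultimately have "(\<lambda>m. indicator B m * pmf (poisson_pmf 1) m) sums p"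
    by simp
  then have "(\<lambda>m. exp 1 * (indicator B m * pmf (poisson_pmf 1) m)) sums (exp 1 * p)"
    by (rule sums_mult)
  then have "(\<lambda>m. indicator B m / fact m) sums (exp 1 * p)"
    by (simp add: exp_minus field_simps)
  then have "(\<lambda>m. indicator B m / fact m - p * (1 / fact m)) sums (exp 1 * p - p * exp 1)"
    by (intro sums_diff sums_mult exp1)
  then have h_sums: "h sums 0"
    by (simp add: h_def[abs_def] diff_divide_distrib)
  text \<open>The partial sums of \<open>h\<close> are estimated through the tails, since \<open>h\<close> sums to 0.\<close>
  have f_bound: "\<bar>f (Suc k)\<bar> \<le> 2" for k
  proof -
    have tail: "(\<lambda>m. fact k * h (m + Suc k)) sums (fact k * (0 - (\<Sum>m<Suc k. h m)))"
      using h_sums by (intro sums_mult) (simp only: sums_iff_shift' sums_split_initial_segment)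
    \<comment> \<open>Since \<open>fact k * fact (Suc m)\<close> divides
      \<open>fact (k + Suc m)\<close>, the tail is dominated termwise by a series independent of
      \<open>k\<close>. Its sum e - 1 is at most 2, which is the source of the bound 2.\<close>
    have term_le: "\<bar>fact k * h (m + Suc k)\<bar> \<le> 1 / fact (Suc m)" for m
    proof -
      have "fact k * fact (Suc m) \<le> (fact (k + Suc m) :: nat)"
        by (rule dvd_imp_le[OF fact_fact_dvd_fact]) simp
      then have "real (fact k * fact (Suc m)) \<le> real (fact (k + Suc m))"
        by (rule of_nat_mono)
      then have "fact k * fact (Suc m) \<le> (fact (m + Suc k) :: real)"
        by (simp only: of_nat_mult of_nat_fact add.commute add_Suc_right add_Suc)
      then have "fact k * (1 / fact (m + Suc k)) \<le> (1 / fact (Suc m) :: real)"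
        by (simp add: field_simps del: fact_Suc)
      moreover have "\<bar>fact k * h (m + Suc k)\<bar> \<le> fact k * (1 / fact (m + Suc k))"
        unfolding abs_mult abs_of_nonneg[OF fact_ge_zero] by (rule mult_left_mono[OF h_le]) simp
      ultimately show ?thesis by linarith
    qed
    have exp_tail: "(\<lambda>m. 1 / fact (Suc m) :: real) sums (exp 1 - 1)"
      using exp1 by (subst sums_Suc_iff) simp
    have "\<bar>\<Sum>m. fact k * h (m + Suc k)\<bar> \<le> (\<Sum>m. 1 / fact (Suc m) :: real)"
      using term_le sums_summable[OF exp_tail] summable_norm_comparison_test
        norm_suminf_le[of "\<lambda>m. fact k * h (m + Suc k)"]
      by (metis real_norm_def)
    also have "\<dots> = exp 1 - 1" using exp_tail by (simp only: sums_iff)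
    also have "\<dots> \<le> 2" using exp_le by simp
    finally show ?thesis
      using tail by (simp add: sums_iff f_def lessThan_Suc_atMost abs_mult)
  qed
  show ?thesis
  proof
    show "\<bar>f k\<bar> \<le> 2" for k
      using f_bound by (cases k) (auto simp: f_def)
    show "f (Suc k) - real k * f k = indicator B k - measure_pmf.prob (poisson_pmf 1) B" for k
    proof -
      have "f (Suc k) - real k * f k = fact k * h k"
        by (cases k) (simp_all add: f_def algebra_simps)
      also have "\<dots> = indicator B k - p" by (simp add: h_def)
      finally show ?thesis by (simp add: p_def)
    qed
  qed
qed

section \<open>Switchings\<close>

text \<open>Left composition with the transposition of \<open>i\<close> and \<open>j\<close>
  exchanges the permutations with \<open>p i = j\<close> and those with \<open>p i = i\<close>, so
  every image of \<open>i\<close> is equally frequent.\<close>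

lemma card_permutes_image_mem:
  assumes "finite X" and "i \<in> X" and "J \<subseteq> X"
  shows "card {p. p permutes X \<and> p i \<in> J} * card X = card J * fact (card X)"
proof -
  have fin: "finite {p. p permutes X}" using assms(1) by (rule finite_permutations)
  have eq: "card {p. p permutes X \<and> p i = j} = card {p. p permutes X \<and> p i = i}"
    if "j \<in> X" for j
  proof (rule bij_betw_same_card[of "\<lambda>p. transpose i j \<circ> p"],
      rule bij_betwI[where g = "\<lambda>p. transpose i j \<circ> p"])
    show "(\<lambda>p. transpose i j \<circ> p) \<in>
        {p. p permutes X \<and> p i = j} \<rightarrow> {p. p permutes X \<and> p i = i}"
      and "(\<lambda>p. transpose i j \<circ> p) \<in>
        {p. p permutes X \<and> p i = i} \<rightarrow> {p. p permutes X \<and> p i = j}"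
      using that assms(2) by (auto intro!: permutes_compose permutes_swap_id)
  qed (simp_all flip: o_assoc add: fun_eq_iff)
  have part: "card {p. p permutes X \<and> p i \<in> L} = card L * card {p. p permutes X \<and> p i = i}"
    if "L \<subseteq> X" for L
  proof -
    have "{p. p permutes X \<and> p i \<in> L} = (\<Union>j\<in>L. {p. p permutes X \<and> p i = j})" by auto
    also have "card \<dots> = (\<Sum>j\<in>L. card {p. p permutes X \<and> p i = j})"
      using that assms(1) fin by (intro card_UN_disjoint) (auto intro: finite_subset)
    also have "\<dots> = card L * card {p. p permutes X \<and> p i = i}"
      using that eq by (simp add: subset_iff)
    finally show ?thesis .
  qed
  have "{p. p permutes X \<and> p i \<in> X} = {p. p permutes X}"
    using assms(2) by (auto simp: permutes_in_image)
  then have "fact (card X) = card X * card {p. p permutes X \<and> p i = i}"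
    using part[of X] card_permutations[OF refl assms(1)] by simp
  then show ?thesis using part[OF assms(3)] by simp
qed

section \<open>Permutations commuting with \<eta> at given points, and the switching
  bijection\<close>

locale fixed_permutation =
  fixes X :: "'a set" and \<eta> :: "'a \<Rightarrow> 'a"
  assumes finite_X: "finite X" and permutes: "\<eta> permutes X"
begin

definition perms :: "('a \<Rightarrow> 'a) set" where
  "perms = {\<pi>. \<pi> permutes X}"

definition commuting :: "('a \<Rightarrow> 'a) \<Rightarrow> 'a set" where
  "commuting \<pi> = {i \<in> X. \<pi> (\<eta> i) = \<eta> (\<pi> i)}"

definition fixpoints :: "'a set" where
  "fixpoints = {i \<in> X. \<eta> i = i}"

text \<open>Points are collected rather than cycles, because the error terms are summed over
  points.\<close>

definition two_cyclic :: "'a set" where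
  "two_cyclic = {i \<in> X. \<eta> i \<noteq> i \<and> \<eta> (\<eta> i) = i}"

definition perms_at :: "'a \<Rightarrow> ('a \<Rightarrow> 'a) set" where
  "perms_at i = {\<sigma> \<in> perms. i \<in> commuting \<sigma>}"

lemma finite_perms [simp]: "finite perms"
  unfolding perms_def by (rule finite_permutations[OF finite_X])

lemma perms_nonempty [simp]: "perms \<noteq> {}"
  using permutes by (auto simp: perms_def)

lemma finite_perms_at [simp]: "finite (perms_at i)"
  by (simp add: perms_at_def)

lemma card_perms: "card perms = fact (card X)"
  unfolding perms_def by (rule card_permutations[OF refl finite_X])

lemma finite_commuting [simp]: "finite (commuting \<pi>)"
  using finite_X by (simp add: commuting_def)

lemma eta_eq_iff [simp]: "\<eta> x = \<eta> y \<longleftrightarrow> x = y"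
  using permutes_inj[OF permutes] by (auto dest: injD)

lemma eta_inv [simp]: "\<eta> (inv \<eta> x) = x" "inv \<eta> (\<eta> x) = x"
  using permutes_inverses[OF permutes] by auto

lemma eta_in_X [simp]: "\<eta> x \<in> X \<longleftrightarrow> x \<in> X" "inv \<eta> x \<in> X \<longleftrightarrow> x \<in> X"
  using permutes permutes_inv[OF permutes] by (simp_all add: permutes_in_image)

lemma perms_eq_iff: "\<sigma> \<in> perms \<Longrightarrow> \<sigma> x = \<sigma> y \<longleftrightarrow> x = y"
  unfolding perms_def by (auto dest: permutes_inj injD)

lemma perms_in_X: "\<sigma> \<in> perms \<Longrightarrow> \<sigma> x \<in> X \<longleftrightarrow> x \<in> X"
  by (simp add: perms_def permutes_in_image)

lemma perms_transpose: "\<sigma> \<in> perms \<Longrightarrow> i \<in> X \<Longrightarrow> x \<in> X \<Longrightarrow> \<sigma> \<circ> transpose i x \<in> perms"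
  unfolding perms_def by (auto intro!: permutes_compose permutes_swap_id)

lemma eta_neq_inv: "\<eta> x \<noteq> x \<Longrightarrow> inv \<eta> x \<noteq> x"
  by (metis eta_inv(1))

text \<open>The point \<open>x\<close> is recovered from the switched permutation as the one that must be sent
  to \<open>inv \<eta> (\<pi> (\<eta> i))\<close> in order to restore commutation at \<open>i\<close>.\<close>

lemma switching_bij:
  assumes i: "i \<in> X" "\<eta> i \<noteq> i"
  shows "bij_betw (\<lambda>(\<sigma>, x). \<sigma> \<circ> transpose i x)
    (perms_at i \<times> (X - {\<eta> i})) {\<pi> \<in> perms. \<pi> (\<eta> i) \<notin> fixpoints}"
proof (rule bij_betwI[where g = "\<lambda>\<pi>. (\<pi> \<circ> transpose i (inv \<pi> (inv \<eta> (\<pi> (\<eta> i)))),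
      inv \<pi> (inv \<eta> (\<pi> (\<eta> i))))"], goal_cases)
  \<comment> \<open>As \<open>x \<noteq> \<eta> i\<close>, the value at \<open>\<eta> i\<close>
    stays \<open>\<eta> (\<sigma> i)\<close>. If \<eta> fixed it, then
    \<open>\<sigma> (\<eta> i) = \<sigma> i\<close>, contrary to
    \<open>\<eta> i \<noteq> i\<close>.\<close>
  case 1
  show ?case
    using i by (auto simp: perms_at_def perms_transpose transpose_eq_iff commuting_def fixpoints_def
        perms_eq_iff)
next
  case 2
  {
    fix \<pi> assume \<pi>: "\<pi> \<in> perms" "\<pi> (\<eta> i) \<notin> fixpoints"
    define x where "x = inv \<pi> (inv \<eta> (\<pi> (\<eta> i)))"
    have x: "\<pi> x = inv \<eta> (\<pi> (\<eta> i))"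
      using \<pi>(1) by (simp add: x_def perms_def permutes_inverses)
    have "x \<in> X" using x i \<pi>(1) by (metis perms_in_X eta_in_X)
    \<comment> \<open>With \<open>x = \<eta> i\<close>, the value \<open>\<pi> (\<eta> i)\<close>
      would equal its own preimage under \<eta> and so be a fixed point.\<close>
    moreover have "x \<noteq> \<eta> i"
      using x \<pi> i by (auto simp: fixpoints_def perms_in_X) (metis eta_inv(1))
    moreover have "\<pi> \<circ> transpose i x \<in> perms_at i"
      using calculation x i \<pi>(1) by (simp add: perms_at_def perms_transpose commuting_def)
    ultimately have "(\<pi> \<circ> transpose i x, x) \<in> perms_at i \<times> (X - {\<eta> i})" by simp
  }
  then show ?case by auto
next
  case (3 z)
  obtain \<sigma> x where z: "z = (\<sigma>, x)" by (cases z)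
  from 3 z have \<sigma>: "\<sigma> \<in> perms" "\<sigma> (\<eta> i) = \<eta> (\<sigma> i)" and x: "x \<in> X" "x \<noteq> \<eta> i"
    by (auto simp: perms_at_def commuting_def)
  have "\<sigma> \<circ> transpose i x \<in> perms" using \<sigma> x i by (simp add: perms_transpose)
  then have "inv (\<sigma> \<circ> transpose i x) (\<sigma> i) = x"
    unfolding perms_def by (auto simp: permutes_inv_eq)
  then show ?case using z \<sigma> x i by (simp add: flip: o_assoc)
next
  case (4 \<pi>)
  then show ?case by (simp flip: o_assoc)
qed

section \<open>Counting permutations that commute at one or two points\<close>

lemma card_perms_at_le:
  assumes "i \<in> X" "\<eta> i \<noteq> i"
  shows "card (perms_at i) * (card X - 1) \<le> fact (card X)"
proof -
  have "card (perms_at i) * (card X - 1) = card (perms_at i \<times> (X - {\<eta> i}))"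
    using assms finite_X by (simp add: card_cartesian_product)
  also have "\<dots> = card {\<pi> \<in> perms. \<pi> (\<eta> i) \<notin> fixpoints}"
    by (rule bij_betw_same_card[OF switching_bij[OF assms]])
  also have "\<dots> \<le> fact (card X)"
    unfolding card_perms[symmetric] by (rule card_mono) auto
  finally show ?thesis .
qed

text \<open>Switching at \<open>k\<close> with an \<open>x\<close> outside
  \<open>{i, \<eta> i}\<close> moves neither \<open>i\<close> nor \<open>\<eta> i\<close>, so
  commutation at \<open>i\<close> survives. The switching is injective, and each permutation
  commuting at both points thus yields at least \<open>card X - 3\<close> permutations commuting at
  \<open>i\<close>.\<close>

lemma card_perms_at_pair_le:
  assumes i: "i \<in> X" and k: "k \<in> X" "\<eta> k \<noteq> k" "k \<noteq> i" "k \<noteq> \<eta> i"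
  shows "card (perms_at i \<inter> perms_at k) * (card X - 3) \<le> card (perms_at i)"
proof -
  have "card X - card {i, \<eta> i, \<eta> k} \<le> card (X - {i, \<eta> i, \<eta> k})"
    by (rule diff_card_le_card_Diff) simp
  moreover have "card {i, \<eta> i, \<eta> k} \<le> 3"
    by (simp add: card_insert_if)
  ultimately have "card (perms_at i \<inter> perms_at k) * (card X - 3)
      \<le> card (perms_at i \<inter> perms_at k) * card (X - {i, \<eta> i, \<eta> k})"
    by (intro mult_le_mono2) linarith
  also have "\<dots> = card ((perms_at i \<inter> perms_at k) \<times> (X - {i, \<eta> i, \<eta> k}))"
    by (simp add: card_cartesian_product)
  also have "\<dots> \<le> card (perms_at i)"
  proof (rule card_inj_on_le[where f = "\<lambda>(\<sigma>, x). \<sigma> \<circ> transpose k x"])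
    show "inj_on (\<lambda>(\<sigma>, x). \<sigma> \<circ> transpose k x)
        ((perms_at i \<inter> perms_at k) \<times> (X - {i, \<eta> i, \<eta> k}))"
      by (rule inj_on_subset[OF bij_betw_imp_inj_on[OF switching_bij[OF k(1,2)]]]) auto
    show "(\<lambda>(\<sigma>, x). \<sigma> \<circ> transpose k x) ` ((perms_at i \<inter> perms_at k) \<times> (X - {i, \<eta> i, \<eta> k}))
        \<subseteq> perms_at i"
      using i k by (auto simp: perms_at_def perms_transpose commuting_def transpose_def)
  qed simp
  finally show ?thesis .
qed

section \<open>Effect of a switching on the set of commuting points\<close>

text \<open>Only the values at \<open>i\<close> and \<open>x\<close> change, so commutation can
  change only at \<open>i\<close>, \<open>x\<close> and their preimages under \<eta>. Commutation at
  \<open>i\<close> is lost because \<open>x \<noteq> i\<close>. At the other three points there was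
  none before, and \<open>new\<close> prevents it from arising at the two preimages.\<close>

lemma commuting_switch:
  assumes \<sigma>: "\<sigma> \<in> perms_at i" and i: "i \<in> X" "\<eta> i \<noteq> i" and pred: "inv \<eta> i \<notin> commuting \<sigma>"
    and x: "x \<in> X" "x \<noteq> i" "x \<noteq> \<eta> i" "x \<noteq> inv \<eta> i"
    and nc: "x \<notin> commuting \<sigma>" "inv \<eta> x \<notin> commuting \<sigma>"
    and new: "\<sigma> x \<noteq> \<eta> (\<sigma> (inv \<eta> i))" "\<eta> (\<sigma> (inv \<eta> x)) \<noteq> \<sigma> i"
  shows "commuting (\<sigma> \<circ> transpose i x) = commuting \<sigma> - {i}"
proof -
  define \<pi> where "\<pi> = \<sigma> \<circ> transpose i x"
  have \<sigma>': "\<sigma> \<in> perms" "\<sigma> (\<eta> i) = \<eta> (\<sigma> i)"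
    using \<sigma> by (auto simp: perms_at_def commuting_def)
  have inj: "\<sigma> u = \<sigma> v \<longleftrightarrow> u = v" for u v using \<sigma>'(1) by (rule perms_eq_iff)
  have \<pi>: "\<pi> i = \<sigma> x" "\<pi> x = \<sigma> i" "\<And>y. y \<noteq> i \<Longrightarrow> y \<noteq> x \<Longrightarrow> \<pi> y = \<sigma> y"
    by (auto simp: \<pi>_def transpose_def)
  have inv_iff: "inv \<eta> y = z \<longleftrightarrow> y = \<eta> z" for y z using eta_inv by metis
  have "y \<in> commuting \<pi> \<longleftrightarrow> y \<in> commuting \<sigma> - {i}" if y: "y \<in> X" for y
  proof -
    consider "y = i" | "y = x" | "y = inv \<eta> i" "y \<noteq> i" "y \<noteq> x" | "y = inv \<eta> x" "y \<noteq> i" "y \<noteq> x"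
      | "y \<notin> {i, x}" "\<eta> y \<notin> {i, x}"
      using inv_iff by fastforce
    then show ?thesis
    proof cases
      case 1
      have "\<pi> (\<eta> i) = \<sigma> (\<eta> i)" using i x by (intro \<pi>(3)) auto
      then show ?thesis using 1 \<sigma>' inj x \<pi>(1) by (auto simp: commuting_def)
    next
      case 2
      \<comment> \<open>Equality would mean \<open>\<pi> (\<eta> x) = \<sigma> (\<eta> i)\<close>.
        This gives \<open>\<eta> i = i\<close> when \<eta> fixes \<open>x\<close>, and
        \<open>x = i\<close> otherwise.\<close>
      have "\<pi> (\<eta> x) \<noteq> \<eta> (\<sigma> i)"
      proof (cases "\<eta> x = x")
        case True
        then show ?thesis using \<pi>(2) \<sigma>'(2) inj i by metis
      next
        case False
        have "\<eta> x \<noteq> i" using x(4) by auto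
        then show ?thesis using False \<pi>(3) \<sigma>'(2) inj x(2) by (metis eta_eq_iff)
      qed
      then show ?thesis using 2 nc \<pi>(2) by (auto simp: commuting_def)
    next
      case 3
      then show ?thesis using pred new(1) \<pi> by (auto simp: commuting_def)
    next
      case 4
      then show ?thesis using nc new(2) \<pi> by (auto simp: commuting_def)
    next
      case 5
      then show ?thesis using \<pi>(3) by (auto simp: commuting_def)
    qed
  qed
  then show ?thesis unfolding \<pi>_def by (auto simp: commuting_def)
qed

section \<open>Bounds of relative order 1/n and 1/n^2, and the resulting second moments\<close>

lemma card_perms_at_le_real:
  assumes "card X \<ge> 4" "i \<in> X" "\<eta> i \<noteq> i"
  shows "real (card (perms_at i)) \<le> 2 * fact (card X) / card X"
proof -
  have "real (card (perms_at i) * (card X - 1)) \<le> real (fact (card X))"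
    using card_perms_at_le[OF assms(2,3)] by (rule of_nat_mono)
  then have "real (card (perms_at i)) * (real (card X) - 1) \<le> fact (card X)"
    using assms(1) by (simp add: of_nat_diff)
  moreover have "real (card (perms_at i)) * (card X / 2) \<le>
      real (card (perms_at i)) * (real (card X) - 1)"
    using assms(1) by (intro mult_left_mono) auto
  ultimately show ?thesis using assms(1) by (simp add: field_simps)
qed

text \<open>The pair bound applies to \<open>(i, k)\<close> unless \<open>k = \<eta> i\<close>, and
  to \<open>(k, i)\<close> unless \<open>i = \<eta> k\<close>. Both fail only if \<open>i\<close>
  and \<open>k\<close> form a 2-cycle; then the bound for commuting at \<open>i\<close> alone is
  used.\<close>

lemma card_perms_at_pair_le_real:
  assumes n: "card X \<ge> 4" and i: "i \<in> X" "\<eta> i \<noteq> i" and k: "k \<in> X" "\<eta> k \<noteq> k" "k \<noteq> i"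
  shows "real (card (perms_at i \<inter> perms_at k)) \<le> 8 * fact (card X) / (card X)\<^sup>2 +
    (if i \<in> two_cyclic \<and> k = inv \<eta> i then 2 * fact (card X) / card X else 0)"
proof -
  have aux: "real (card (perms_at i \<inter> perms_at k)) \<le> 8 * fact (card X) / (card X)\<^sup>2"
    if i: "i \<in> X" "\<eta> i \<noteq> i" and k: "k \<in> X" "\<eta> k \<noteq> k" "k \<noteq> i" "k \<noteq> \<eta> i" for i k
  proof -
    define c where "c = card (perms_at i \<inter> perms_at k)"
    have "real (c * (card X - 3)) \<le> card (perms_at i)"
      unfolding c_def using card_perms_at_pair_le[OF i(1) k] by (rule of_nat_mono)
    also have "\<dots> \<le> 2 * fact (card X) / card X" by (rule card_perms_at_le_real[OF n i])
    finally have "real c * (real (card X) - 3) \<le> 2 * fact (card X) / card X"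
      using n by (simp add: of_nat_diff)
    \<comment> \<open>The inequality n - 3 >= n/4 holds exactly for n >= 4, whence the threshold 4.
      The constant 8 is 4 times the 2 of the one-point bound.\<close>
    moreover have "real c * (card X / 4) \<le> real c * (real (card X) - 3)"
      using n by (intro mult_left_mono) auto
    ultimately have "real c * (card X / 4) \<le> 2 * fact (card X) / card X" by linarith
    then show ?thesis using n by (simp add: c_def field_simps power2_eq_square)
  qed
  show ?thesis
  proof (cases "k = \<eta> i")
    case False
    then show ?thesis using aux[OF i k] by (auto intro: add_increasing2)
  next
    case k_eq: True
    show ?thesis
    proof (cases "i = \<eta> k")
      case False
      then show ?thesis
        using aux[OF k(1,2) i k(3)[symmetric]] by (auto intro: add_increasing2 simp: Int_commute)
    next
      case True
      then have "i \<in> two_cyclic \<and> k = inv \<eta> i" using k_eq i eta_inv(2)[of k]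
        by (simp add: two_cyclic_def)
      moreover have "real (card (perms_at i \<inter> perms_at k)) \<le> card (perms_at i)"
        by (intro of_nat_mono card_mono) auto
      ultimately show ?thesis
        using card_perms_at_le_real[OF n i] by (auto intro: add_increasing)
    qed
  qed
qed

text \<open>If \<eta> fixes \<open>i\<close>, commuting at \<open>i\<close> means that the image of
  \<open>i\<close> is again fixed by \<eta>, and this image is uniform on \<open>X\<close>.\<close>

lemma card_perms_at_fixpoint:
  assumes "i \<in> fixpoints"
  shows "card (perms_at i) * card X = card fixpoints * fact (card X)"
proof -
  have "perms_at i = {p. p permutes X \<and> p i \<in> fixpoints}"
    using assms by (auto simp: perms_at_def perms_def commuting_def fixpoints_def permutes_in_image)
  then show ?thesis
    using card_permutes_image_mem[OF finite_X, of i fixpoints] assms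
    by (simp add: fixpoints_def)
qed

text \<open>Double counting of pairs of a permutation and a point where it commutes. It serves for
  the sum of W f(W) over all permutations and, with \<open>g\<close> constantly 1, for the sum of W
  over \<open>perms_at i\<close>.\<close>

lemma sum_commuting_swap:
  assumes "A \<subseteq> perms"
  shows "(\<Sum>\<sigma>\<in>A. \<Sum>k\<in>commuting \<sigma>. (g \<sigma> :: real)) = (\<Sum>k\<in>X. \<Sum>\<sigma>\<in>A \<inter> perms_at k. g \<sigma>)"
proof -
  have A: "finite A" using assms by (rule finite_subset) simp
  have "commuting \<sigma> = {k \<in> X. \<sigma> \<in> perms_at k}" if "\<sigma> \<in> A" for \<sigma>
    using that assms by (auto simp: perms_at_def commuting_def)
  moreover have "A \<inter> perms_at k = {\<sigma> \<in> A. \<sigma> \<in> perms_at k}" for k by auto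
  ultimately show ?thesis
    using sum.swap_restrict[OF A finite_X, of "\<lambda>\<sigma> k. g \<sigma>" "\<lambda>\<sigma> k. \<sigma> \<in> perms_at k"] by simp
qed

text \<open>The sum counts commutation at both \<open>i\<close> and \<open>k\<close>, over all
  \<open>k\<close>. For \<open>k = i\<close> and for fixed points \<open>k\<close> the one-point
  bound is used; the other \<open>k\<close> contribute order 1/n^2 each, apart from the partner of
  \<open>i\<close> in a 2-cycle.\<close>

lemma sum_card_commuting_le:
  assumes n: "card X \<ge> 4" and i: "i \<in> X" "\<eta> i \<noteq> i"
  shows "(\<Sum>\<sigma>\<in>perms_at i. real (card (commuting \<sigma>))) \<le>
    (card fixpoints + 1) * (2 * fact (card X) / card X) + 8 * fact (card X) / card X +
    (if i \<in> two_cyclic then 2 * fact (card X) / card X else 0)"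
proof -
  define N :: real where "N = fact (card X)"
  define P where "P k = real (card (perms_at i \<inter> perms_at k))" for k
  have fin: "finite fixpoints" using finite_X by (simp add: fixpoints_def)
  have P_le: "P k \<le> 2 * N / card X" for k
  proof -
    have "P k \<le> card (perms_at i)" unfolding P_def by (intro of_nat_mono card_mono) auto
    then show ?thesis using card_perms_at_le_real[OF n i] by (simp add: N_def)
  qed
  have "(\<Sum>\<sigma>\<in>perms_at i. real (card (commuting \<sigma>))) = (\<Sum>k\<in>X. P k)"
    using sum_commuting_swap[of "perms_at i" "\<lambda>_. 1"] by (simp add: perms_at_def P_def)
  also have "\<dots> = (\<Sum>k\<in>insert i fixpoints. P k) + (\<Sum>k\<in>X - insert i fixpoints. P k)"
    using finite_X i by (subst sum.subset_diff[of "insert i fixpoints"]) (auto simp: fixpoints_def)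
  also have "(\<Sum>k\<in>insert i fixpoints. P k) \<le> (card fixpoints + 1) * (2 * N / card X)"
  proof -
    have "card (insert i fixpoints) = card fixpoints + 1" using i fin by (simp add: fixpoints_def)
    then show ?thesis
      using sum_bounded_above[of "insert i fixpoints" P "2 * N / card X"] P_le by simp
  qed
  \<comment> \<open>The condition on \<open>k\<close> is placed outermost so that, after extension
    to all of \<open>X\<close>, the exceptional term is collected exactly once.\<close>
  also have "(\<Sum>k\<in>X - insert i fixpoints. P k) \<le> (\<Sum>k\<in>X - insert i fixpoints. 8 * N / (card X)\<^sup>2 +
      (if k = inv \<eta> i then (if i \<in> two_cyclic then 2 * N / card X else 0) else 0))"
  proof (rule sum_mono)
    fix k assume "k \<in> X - insert i fixpoints"
    then have "k \<in> X" "\<eta> k \<noteq> k" "k \<noteq> i" by (auto simp: fixpoints_def)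
    from card_perms_at_pair_le_real[OF n i this]
    show "P k \<le> 8 * N / (card X)\<^sup>2 +
        (if k = inv \<eta> i then (if i \<in> two_cyclic then 2 * N / card X else 0) else 0)"
      unfolding N_def P_def by (auto split: if_splits)
  qed
  also have "\<dots> \<le> (\<Sum>k\<in>X. 8 * N / (card X)\<^sup>2 +
      (if k = inv \<eta> i then (if i \<in> two_cyclic then 2 * N / card X else 0) else 0))"
    using finite_X by (intro sum_mono2) (auto simp: N_def)
  also have "\<dots> = card X * (8 * N / (card X)\<^sup>2) + (if i \<in> two_cyclic then 2 * N / card X else 0)"
    using finite_X i by (simp add: sum.distrib)
  also have "card X * (8 * N / (card X)\<^sup>2) = 8 * N / card X"
    using n by (simp add: power2_eq_square)
  finally have "(\<Sum>\<sigma>\<in>perms_at i. real (card (commuting \<sigma>))) \<le>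
      (card fixpoints + 1) * (2 * N / card X) + (8 * N / card X +
      (if i \<in> two_cyclic then 2 * N / card X else 0))" by simp
  then show ?thesis unfolding N_def add.assoc .
qed

section \<open>Defective switchings and the Stein estimate\<close>

text \<open>A switching is defective only if a hypothesis of \<open>commuting_switch\<close> fails.
  For given \<sigma> this excludes at most 4 + 2W choices of \<open>x\<close>, W being the number of
  commuting points; if \<sigma> also commutes at \<open>inv \<eta> i\<close>, all \<open>x\<close>
  are given up. That second event is rare unless \<open>i\<close> lies on a 2-cycle.\<close>

lemma card_defective_switchings_le:
  assumes n: "card X \<ge> 4" and i: "i \<in> X" "\<eta> i \<noteq> i"
  defines "D \<equiv> {(\<sigma>, x) \<in> perms_at i \<times> (X - {\<eta> i}).
    Suc (card (commuting (\<sigma> \<circ> transpose i x))) \<noteq> card (commuting \<sigma>)}"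
  shows "real (card D) \<le> fact (card X) / card X * (36 + 4 * card fixpoints) +
    (if i \<in> two_cyclic then 6 * fact (card X) else 0)"
proof -
  define N :: real where "N = fact (card X)"
  \<comment> \<open>The two images of commuting points under the identity and \<eta> reflect the
    conditions \<open>nc\<close>; the last two points are the unique violators of the two conditions
    \<open>new\<close>.\<close>
  define bad where "bad \<sigma> = {i, inv \<eta> i} \<union> commuting \<sigma> \<union> \<eta> ` commuting \<sigma> \<union>
    {inv \<sigma> (\<eta> (\<sigma> (inv \<eta> i))), \<eta> (inv \<sigma> (inv \<eta> (\<sigma> i)))}" for \<sigma>
  have D_sub: "D \<subseteq> (SIGMA \<sigma>:perms_at i. bad \<sigma>) \<union> (perms_at i \<inter> perms_at (inv \<eta> i)) \<times> X"
  proof (rule subrelI)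
    fix \<sigma> x assume "(\<sigma>, x) \<in> D"
    then have \<sigma>: "\<sigma> \<in> perms_at i" and x: "x \<in> X" "x \<noteq> \<eta> i"
      and neq: "Suc (card (commuting (\<sigma> \<circ> transpose i x))) \<noteq> card (commuting \<sigma>)"
      by (auto simp: D_def)
    have \<sigma>': "\<sigma> permutes X" "i \<in> commuting \<sigma>" using \<sigma> by (auto simp: perms_at_def perms_def)
    show "(\<sigma>, x) \<in> (SIGMA \<sigma>:perms_at i. bad \<sigma>) \<union> (perms_at i \<inter> perms_at (inv \<eta> i)) \<times> X"
    proof (rule ccontr)
      assume contra: "\<not> ?thesis"
      then have b: "x \<notin> bad \<sigma>" and pred: "inv \<eta> i \<notin> commuting \<sigma>"
        using \<sigma> x by (auto simp: perms_at_def)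
      have "\<sigma> x \<noteq> \<eta> (\<sigma> (inv \<eta> i))"
        using b \<sigma>'(1) by (metis UnCI bad_def insertCI permutes_inverses(2))
      moreover have "\<eta> (\<sigma> (inv \<eta> x)) \<noteq> \<sigma> i"
        using b \<sigma>'(1) by (metis UnCI bad_def eta_inv insertCI permutes_inverses(2))
      moreover have "inv \<eta> x \<notin> commuting \<sigma>"
        using b by (metis UnCI bad_def eta_inv(1) imageI)
      ultimately have "commuting (\<sigma> \<circ> transpose i x) = commuting \<sigma> - {i}"
        using b x pred by (intro commuting_switch[OF \<sigma> i]) (auto simp: bad_def)
      then show False using neq card_Suc_Diff1[OF finite_commuting \<sigma>'(2)] by (simp only: not_True_eq_False)
    qed
  qed
  have card_bad: "card (bad \<sigma>) \<le> 4 + 2 * card (commuting \<sigma>)" for \<sigma>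
  proof -
    have "card (bad \<sigma>) \<le> (card {i, inv \<eta> i} + card (commuting \<sigma>) + card (\<eta> ` commuting \<sigma>)) +
        card {inv \<sigma> (\<eta> (\<sigma> (inv \<eta> i))), \<eta> (inv \<sigma> (inv \<eta> (\<sigma> i)))}"
      unfolding bad_def by (intro order_trans[OF card_Un_le] add_mono order_refl)
    moreover have "card {i, inv \<eta> i} \<le> 2"
      and "card {inv \<sigma> (\<eta> (\<sigma> (inv \<eta> i))), \<eta> (inv \<sigma> (inv \<eta> (\<sigma> i)))} \<le> 2"
      by (simp_all add: card_insert_if)
    moreover have "card (\<eta> ` commuting \<sigma>) \<le> card (commuting \<sigma>)" by (simp add: card_image_le)
    ultimately show ?thesis by linarith
  qed
  have fin_bad: "finite (bad \<sigma>)" for \<sigma> by (simp add: bad_def)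
  have "card D \<le> card (SIGMA \<sigma>:perms_at i. bad \<sigma>) + card ((perms_at i \<inter> perms_at (inv \<eta> i)) \<times> X)"
    using finite_X fin_bad
    by (intro order_trans[OF card_mono[OF _ D_sub] card_Un_le]) auto
  also have "card (SIGMA \<sigma>:perms_at i. bad \<sigma>) \<le> (\<Sum>\<sigma>\<in>perms_at i. 4 + 2 * card (commuting \<sigma>))"
    using fin_bad card_bad by (simp add: card_SigmaI sum_mono)
  finally have "card D \<le> 4 * card (perms_at i) + 2 * (\<Sum>\<sigma>\<in>perms_at i. card (commuting \<sigma>)) +
      card (perms_at i \<inter> perms_at (inv \<eta> i)) * card X"
    by (simp add: card_cartesian_product sum.distrib sum_distrib_left mult.commute)
  then have "real (card D) \<le> real (4 * card (perms_at i) +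
      2 * (\<Sum>\<sigma>\<in>perms_at i. card (commuting \<sigma>)) +
      card (perms_at i \<inter> perms_at (inv \<eta> i)) * card X)"
    by (rule of_nat_mono)
  then have "real (card D) \<le> 4 * real (card (perms_at i)) +
      2 * (\<Sum>\<sigma>\<in>perms_at i. real (card (commuting \<sigma>))) +
      real (card (perms_at i \<inter> perms_at (inv \<eta> i))) * card X"
    by simp
  also have "\<dots> \<le> 4 * (2 * N / card X) +
      2 * ((card fixpoints + 1) * (2 * N / card X) + 8 * N / card X +
        (if i \<in> two_cyclic then 2 * N / card X else 0)) +
      (8 * N / (card X)\<^sup>2 + (if i \<in> two_cyclic then 2 * N / card X else 0)) * card X"
    using card_perms_at_le_real[OF n i] sum_card_commuting_le[OF n i]
      card_perms_at_pair_le_real[OF n i, of "inv \<eta> i"] i eta_neq_inv[OF i(2)]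
    unfolding N_def
    by (intro add_mono mult_left_mono mult_right_mono) (auto simp: ac_simps)
  \<comment> \<open>Here 36 = 8 + 4 + 16 + 8: four times the one-point bound, twice the second
    moment (4 and 16), and the pair \<open>i\<close>, \<open>inv \<eta> i\<close>.\<close>
  also have "\<dots> = N / card X * (36 + 4 * card fixpoints) +
      (if i \<in> two_cyclic then 4 * N / card X + 2 * N else 0)"
    using n by (simp add: field_simps power2_eq_square)
  also have "\<dots> \<le> N / card X * (36 + 4 * card fixpoints) + (if i \<in> two_cyclic then 6 * N else 0)"
    using n by (auto simp: field_simps N_def intro: mult_left_mono)
  finally show ?thesis unfolding N_def .
qed

text \<open>Both sums are written over the domain of the switching bijection, up to small
  remainders. On non-defective pairs the summands cancel, and on defective ones they differ by at
  most 4.\<close>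

lemma switching_estimate:
  fixes f :: "nat \<Rightarrow> real"
  assumes n: "card X \<ge> 4" and i: "i \<in> X" "\<eta> i \<noteq> i" and f: "\<And>k. \<bar>f k\<bar> \<le> 2"
  shows "\<bar>card X * (\<Sum>\<sigma>\<in>perms_at i. f (card (commuting \<sigma>))) -
      (\<Sum>\<pi>\<in>perms. f (Suc (card (commuting \<pi>))))\<bar> \<le>
    fact (card X) / card X * (148 + 18 * card fixpoints) +
    (if i \<in> two_cyclic then 24 * fact (card X) else 0)"
proof -
  define N :: real where "N = fact (card X)"
  define W where "W \<pi> = card (commuting \<pi>)" for \<pi>
  define A where "A = perms_at i \<times> (X - {\<eta> i})"
  define D where "D = {(\<sigma>, x) \<in> A. Suc (W (\<sigma> \<circ> transpose i x)) \<noteq> W \<sigma>}"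
  define B where "B = {\<pi> \<in> perms. \<pi> (\<eta> i) \<in> fixpoints}"
  have fin_A: "finite A" using finite_X by (simp add: A_def)
  have D_sub: "D \<subseteq> A" by (auto simp: D_def)
  have "card B * card X = card fixpoints * fact (card X)"
    unfolding B_def perms_def
    using card_permutes_image_mem[OF finite_X, of "\<eta> i" fixpoints] i
    by (simp add: fixpoints_def)
  then have "real (card B * card X) = real (card fixpoints * fact (card X))" by simp
  then have card_B: "real (card B) = card fixpoints * N / card X"
    using n by (simp add: N_def field_simps)
  \<comment> \<open>The point \<open>x\<close> takes only n - 1 values, so one copy of the sum is
    left over; it becomes the remainder \<open>rem1\<close>.\<close>
  have "card X * (\<Sum>\<sigma>\<in>perms_at i. f (W \<sigma>)) =
      (\<Sum>\<sigma>\<in>perms_at i. (real (card X) - 1) * f (W \<sigma>)) + (\<Sum>\<sigma>\<in>perms_at i. f (W \<sigma>))"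
    by (simp add: sum_distrib_left algebra_simps flip: sum.distrib)
  also have "(\<Sum>\<sigma>\<in>perms_at i. (real (card X) - 1) * f (W \<sigma>)) = (\<Sum>(\<sigma>, x)\<in>A. f (W \<sigma>))"
    using finite_X i n by (simp add: A_def sum.cartesian_product[symmetric] of_nat_diff)
  finally have lhs: "card X * (\<Sum>\<sigma>\<in>perms_at i. f (W \<sigma>)) =
      (\<Sum>(\<sigma>, x)\<in>A. f (W \<sigma>)) + (\<Sum>\<sigma>\<in>perms_at i. f (W \<sigma>))" .
  have "(\<Sum>\<pi>\<in>perms. f (Suc (W \<pi>))) =
      (\<Sum>\<pi>\<in>perms - B. f (Suc (W \<pi>))) + (\<Sum>\<pi>\<in>B. f (Suc (W \<pi>)))"
    by (rule sum.subset_diff) (auto simp: B_def)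
  also have "perms - B = {\<pi> \<in> perms. \<pi> (\<eta> i) \<notin> fixpoints}" by (auto simp: B_def)
  also have "(\<Sum>\<pi>\<in>\<dots>. f (Suc (W \<pi>))) =
      (\<Sum>(\<sigma>, x)\<in>A. f (Suc (W (\<sigma> \<circ> transpose i x))))"
    using sum.reindex_bij_betw[OF switching_bij[OF i], of "\<lambda>\<pi>. f (Suc (W \<pi>))", symmetric]
    by (simp add: A_def case_prod_unfold)
  finally have rhs: "(\<Sum>\<pi>\<in>perms. f (Suc (W \<pi>))) =
      (\<Sum>(\<sigma>, x)\<in>A. f (Suc (W (\<sigma> \<circ> transpose i x)))) + (\<Sum>\<pi>\<in>B. f (Suc (W \<pi>)))" .
  have bound: "\<bar>\<Sum>z\<in>Z. g z\<bar> \<le> c * card Z"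
    if "\<And>z. \<bar>g z\<bar> \<le> c" for Z :: "'z set" and g :: "'z \<Rightarrow> real" and c
    using sum_norm_bound[of Z g c] that by (simp add: mult.commute)
  have "(\<Sum>(\<sigma>, x)\<in>A. f (W \<sigma>)) - (\<Sum>(\<sigma>, x)\<in>A. f (Suc (W (\<sigma> \<circ> transpose i x)))) =
      (\<Sum>(\<sigma>, x)\<in>A. f (W \<sigma>) - f (Suc (W (\<sigma> \<circ> transpose i x))))"
    by (simp add: case_prod_unfold sum_subtractf)
  also have "\<dots> = (\<Sum>(\<sigma>, x)\<in>D. f (W \<sigma>) - f (Suc (W (\<sigma> \<circ> transpose i x))))"
    using fin_A D_sub by (intro sum.mono_neutral_right) (auto simp: D_def)
  also have "\<bar>\<dots>\<bar> \<le> 4 * real (card D)"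
  proof (rule bound)
    fix z
    show "\<bar>case z of (\<sigma>, x) \<Rightarrow> f (W \<sigma>) - f (Suc (W (\<sigma> \<circ> transpose i x)))\<bar> \<le> 4"
      using f[of "W (fst z)"] f[of "Suc (W (fst z \<circ> transpose i (snd z)))"]
      by (cases z) simp
  qed
  also have "4 * real (card D) \<le> 4 * (N / card X * (36 + 4 * card fixpoints) +
      (if i \<in> two_cyclic then 6 * N else 0))"
    unfolding N_def D_def A_def W_def
    by (rule mult_left_mono[OF card_defective_switchings_le[OF n i]]) simp
  finally have main: "\<bar>(\<Sum>(\<sigma>, x)\<in>A. f (W \<sigma>)) - (\<Sum>(\<sigma>, x)\<in>A. f (Suc (W (\<sigma> \<circ> transpose i x))))\<bar>
      \<le> 4 * (N / card X * (36 + 4 * card fixpoints) + (if i \<in> two_cyclic then 6 * N else 0))" .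
  have "\<bar>\<Sum>\<sigma>\<in>perms_at i. f (W \<sigma>)\<bar> \<le> 2 * real (card (perms_at i))" using f by (rule bound)
  then have rem1: "\<bar>\<Sum>\<sigma>\<in>perms_at i. f (W \<sigma>)\<bar> \<le> 2 * (2 * N / card X)"
    using card_perms_at_le_real[OF n i] by (simp add: N_def)
  have rem2: "\<bar>\<Sum>\<pi>\<in>B. f (Suc (W \<pi>))\<bar> \<le> 2 * (card fixpoints * N / card X)"
    using f unfolding card_B[symmetric] by (rule bound)
  have "\<bar>card X * (\<Sum>\<sigma>\<in>perms_at i. f (W \<sigma>)) - (\<Sum>\<pi>\<in>perms. f (Suc (W \<pi>)))\<bar> \<le>
      4 * (N / card X * (36 + 4 * card fixpoints) + (if i \<in> two_cyclic then 6 * N else 0)) +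
      2 * (2 * N / card X) + 2 * (card fixpoints * N / card X)"
    using main rem1 rem2 unfolding lhs rhs by linarith
  also have "\<dots> = N / card X * (148 + 18 * card fixpoints) + (if i \<in> two_cyclic then 24 * N else 0)"
    by (simp add: add_divide_distrib algebra_simps)
  finally show ?thesis unfolding W_def N_def .
qed

text \<open>Summing the discrepancies \<open>E i\<close> over all \<open>i\<close> gives n times the
  Stein expression up to sign. Points moved by \<eta> are handled by switching. Fixed points get a
  crude bound without cancellation, affordable because it is multiplied only by their
  number.\<close>

lemma stein_estimate:
  fixes f :: "nat \<Rightarrow> real"
  assumes n: "card X \<ge> 4" and f: "\<And>k. \<bar>f k\<bar> \<le> 2"
  shows "card X * \<bar>\<Sum>\<sigma>\<in>perms. f (Suc (card (commuting \<sigma>))) -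
      card (commuting \<sigma>) * f (card (commuting \<sigma>))\<bar> \<le>
    fact (card X) * (148 + 20 * real (card fixpoints) + 2 * (real (card fixpoints))\<^sup>2 +
      24 * real (card two_cyclic))"
proof -
  define N :: real where "N = fact (card X)"
  define W where "W \<pi> = card (commuting \<pi>)" for \<pi>
  define E where "E i = card X * (\<Sum>\<sigma>\<in>perms_at i. f (W \<sigma>)) - (\<Sum>\<pi>\<in>perms. f (Suc (W \<pi>)))" for i
  have bound: "\<bar>\<Sum>\<pi>\<in>Z. f (g \<pi>)\<bar> \<le> 2 * real (card Z)" for Z :: "('a \<Rightarrow> 'a) set" and g
    using sum_norm_bound[of Z "\<lambda>\<pi>. f (g \<pi>)" 2] f by (simp add: mult.commute)
  have card_perms': "real (card perms) = N" by (simp add: card_perms N_def)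
  have fixed: "\<bar>E i\<bar> \<le> 2 * card fixpoints * N + 2 * N" if "i \<in> fixpoints" for i
  proof -
    have "real (card (perms_at i) * card X) = real (card fixpoints * fact (card X))"
      using card_perms_at_fixpoint[OF that] by simp
    then have "card X * (2 * real (card (perms_at i))) = 2 * card fixpoints * N"
      by (simp add: N_def mult.commute)
    moreover have "\<bar>card X * (\<Sum>\<sigma>\<in>perms_at i. f (W \<sigma>))\<bar> \<le> card X * (2 * real (card (perms_at i)))"
      unfolding abs_mult using bound by (intro mult_mono) auto
    moreover have "\<bar>\<Sum>\<pi>\<in>perms. f (Suc (W \<pi>))\<bar> \<le> 2 * N"
      unfolding card_perms'[symmetric] by (rule bound)
    ultimately show ?thesis unfolding E_def by linarith
  qed
  have nonfix: "\<bar>E i\<bar> \<le> N / card X * (148 + 18 * card fixpoints) +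
      (if i \<in> two_cyclic then 24 * N else 0)" if "i \<in> X - fixpoints" for i
    using switching_estimate[where f = f, OF n _ _ f, of i] that
    unfolding E_def W_def N_def by (simp add: fixpoints_def)
  have "(\<Sum>\<sigma>\<in>perms. W \<sigma> * f (W \<sigma>)) = (\<Sum>i\<in>X. \<Sum>\<sigma>\<in>perms_at i. f (W \<sigma>))"
    using sum_commuting_swap[of perms "\<lambda>\<sigma>. f (W \<sigma>)"]
    by (simp add: W_def perms_at_def Int_def)
  then have "card X * (\<Sum>\<sigma>\<in>perms. f (Suc (W \<sigma>)) - W \<sigma> * f (W \<sigma>)) = - (\<Sum>i\<in>X. E i)"
    by (simp add: E_def sum_subtractf sum_distrib_left algebra_simps)
  then have "card X * \<bar>\<Sum>\<sigma>\<in>perms. f (Suc (W \<sigma>)) - W \<sigma> * f (W \<sigma>)\<bar> = \<bar>\<Sum>i\<in>X. E i\<bar>"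
    by (metis abs_minus_cancel abs_mult abs_of_nat)
  also have "\<dots> \<le> (\<Sum>i\<in>X. \<bar>E i\<bar>)" by (rule sum_abs)
  also have "\<dots> = (\<Sum>i\<in>X - fixpoints. \<bar>E i\<bar>) + (\<Sum>i\<in>fixpoints. \<bar>E i\<bar>)"
    using finite_X by (intro sum.subset_diff) (auto simp: fixpoints_def)
  also have "(\<Sum>i\<in>fixpoints. \<bar>E i\<bar>) \<le> card fixpoints * (2 * card fixpoints * N + 2 * N)"
    using fixed by (rule sum_bounded_above)
  also have "(\<Sum>i\<in>X - fixpoints. \<bar>E i\<bar>) \<le> (\<Sum>i\<in>X - fixpoints.
      N / card X * (148 + 18 * card fixpoints) + (if i \<in> two_cyclic then 24 * N else 0))"
    using nonfix by (rule sum_mono)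
  also have "\<dots> \<le> (\<Sum>i\<in>X.
      N / card X * (148 + 18 * card fixpoints) + (if i \<in> two_cyclic then 24 * N else 0))"
    using finite_X by (intro sum_mono2) (auto simp: N_def)
  also have "\<dots> = N * (148 + 18 * card fixpoints) + 24 * N * card two_cyclic"
  proof -
    have "X \<inter> two_cyclic = two_cyclic" by (auto simp: two_cyclic_def)
    moreover have "(\<Sum>i\<in>X. if i \<in> two_cyclic then 24 * N else 0) =
        (\<Sum>i\<in>X \<inter> two_cyclic. 24 * N)"
      by (rule sum.inter_restrict[OF finite_X, symmetric])
    ultimately show ?thesis using n by (simp add: sum.distrib)
  qed
  finally show ?thesis
    by (simp add: W_def N_def algebra_simps power2_eq_square)
qed

section \<open>Passage to cycles, commutators and total variation\<close>

text \<open>Every point of \<open>two_cyclic\<close> lies in its own orbit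
  \<open>{i, \<eta> i}\<close>, which has two elements, so these orbits cover the set.\<close>

lemma card_two_cyclic_le: "card two_cyclic \<le> 2 * card {C \<in> orbit \<eta> ` X. card C = 2}"
proof -
  have "orbit \<eta> i = {i, \<eta> i}" if "i \<in> two_cyclic" for i
  proof -
    have "(\<eta> ^^ 2) i = i" using that by (simp add: two_cyclic_def numeral_2_eq_2)
    then have "orbit \<eta> i = {(\<eta> ^^ m) i | m. m < 2}" by (rule orbit_altdef_bounded) simp
    also have "\<dots> = {i, \<eta> i}" by (auto simp: less_2_cases_iff intro: exI[of _ 0] exI[of _ 1])
    finally show ?thesis .
  qed
  then have "two_cyclic \<subseteq> \<Union>{C \<in> orbit \<eta> ` X. card C = 2}"
    by (fastforce simp: two_cyclic_def)
  moreover have fin: "finite C" if "card C = 2" for C :: "'a set"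
    using that by (intro card_ge_0_finite) simp
  ultimately have "card two_cyclic \<le> card (\<Union>{C \<in> orbit \<eta> ` X. card C = 2})"
    using finite_X by (intro card_mono finite_Union) auto
  also have "\<dots> \<le> (\<Sum>C\<in>{C \<in> orbit \<eta> ` X. card C = 2}. card C)"
    by (rule card_Union_le_sum_card)
  finally show ?thesis by (simp add: mult.commute)
qed

lemma fixed_points_commutator:
  assumes "\<pi> \<in> perms"
  shows "{i \<in> X. commutator \<eta> \<pi> i = i} = commuting \<pi>"
proof -
  have "commutator \<eta> \<pi> i = i \<longleftrightarrow> \<pi> (\<eta> i) = \<eta> (\<pi> i)" for i
  proof -
    have "commutator \<eta> \<pi> i = i \<longleftrightarrow> inv \<pi> (\<eta> (\<pi> i)) = \<eta> i"
      by (auto simp: commutator_def permutes_inv_eq[OF permutes])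
    then show ?thesis using assms by (simp add: perms_def permutes_inv_eq)
  qed
  then show ?thesis by (simp add: commuting_def)
qed

text \<open>Averaging the Stein equation for \<open>B\<close> over all permutations turns its right
  side into the difference of the two probabilities; the factor n! then cancels from the
  estimate.\<close>

lemma prob_commuting_poisson_le:
  assumes n: "card X \<ge> 4"
  shows "\<bar>measure_pmf.prob (map_pmf (\<lambda>\<pi>. card (commuting \<pi>)) (pmf_of_set perms)) B -
      measure_pmf.prob (poisson_pmf 1) B\<bar> \<le>
    (148 + 20 * real (card fixpoints) + 2 * (real (card fixpoints))\<^sup>2 +
      24 * real (card two_cyclic)) / card X"
proof -
  define W where "W \<pi> = card (commuting \<pi>)" for \<pi>
  define p where "p = measure_pmf.prob (poisson_pmf 1) B"
  obtain f where f: "\<And>k. \<bar>f k\<bar> \<le> 2"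
    and stein: "\<And>k. f (Suc k) - real k * f k = indicator B k - p"
    unfolding p_def using stein_poisson_1 by blast
  have N: "real (card perms) = fact (card X)" by (simp add: card_perms)
  have "(\<Sum>\<sigma>\<in>perms. f (Suc (W \<sigma>)) - W \<sigma> * f (W \<sigma>)) = card (perms \<inter> W -` B) - card perms * p"
    unfolding stein sum_subtractf by (simp add: indicator_def sum.If_cases Int_def vimage_def)
  also have "\<dots> = fact (card X) * (measure_pmf.prob (map_pmf W (pmf_of_set perms)) B - p)"
    by (simp add: measure_pmf_of_set field_simps N)
  finally have "card X * (fact (card X) * \<bar>measure_pmf.prob (map_pmf W (pmf_of_set perms)) B - p\<bar>) \<le>
      fact (card X) * (148 + 20 * real (card fixpoints) + 2 * (real (card fixpoints))\<^sup>2 +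
      24 * real (card two_cyclic))"
    using stein_estimate[where f = f, OF n f] by (simp add: W_def abs_mult)
  then have "card X * \<bar>measure_pmf.prob (map_pmf W (pmf_of_set perms)) B - p\<bar> \<le>
      148 + 20 * real (card fixpoints) + 2 * (real (card fixpoints))\<^sup>2 +
      24 * real (card two_cyclic)"
    by (simp add: mult.left_commute)
  moreover have "W = (\<lambda>\<pi>. card (commuting \<pi>))" by (auto simp: W_def)
  ultimately show ?thesis
    using n by (simp add: p_def pos_le_divide_eq mult.commute)
qed

end

theorem theorem6p1:
  fixes a b :: real
  assumes "a > 0" and "b > 0"
  shows "\<exists>K :: real. \<forall>n :: nat. n \<ge> 1 \<longrightarrow>
    (\<forall>\<eta> \<in> sym_perms n.
       real (num_fixed_points n \<eta>) \<le> a \<longrightarrow>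
       real (num_cycles_of_length 2 n \<eta>) \<le> b \<longrightarrow>
       tv_dist
         (map_pmf (\<lambda>\<pi>. num_fixed_points n (commutator \<eta> \<pi>)) (pmf_of_set (sym_perms n)))
         (poisson_pmf 1)
       \<le> K / real n)"
proof (intro exI allI impI ballI)
  fix n :: nat and \<eta>
  assume n: "n \<ge> 1" and \<eta>: "\<eta> \<in> sym_perms n"
    and fixed: "real (num_fixed_points n \<eta>) \<le> a"
    and two: "real (num_cycles_of_length 2 n \<eta>) \<le> b"
  interpret fixed_permutation "{1..n}" \<eta>
    using \<eta> by unfold_locales (auto simp: sym_perms_def)
  define P where "P = map_pmf (\<lambda>\<pi>. num_fixed_points n (commutator \<eta> \<pi>)) (pmf_of_set (sym_perms n))"
  \<comment> \<open>The term 48 b is 24 times the bound 2 b for the number of points on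
    2-cycles.\<close>
  define K where "K = 148 + 20 * a + 2 * a\<^sup>2 + 48 * b"
  have perms: "perms = sym_perms n" by (simp only: perms_def sym_perms_def)
  have P: "P = map_pmf (\<lambda>\<pi>. card (commuting \<pi>)) (pmf_of_set perms)"
    unfolding P_def perms[symmetric] num_fixed_points_def
    by (rule map_pmf_cong)
      (simp_all only: set_pmf_of_set[OF perms_nonempty finite_perms] fixed_points_commutator)
  have F: "real (card fixpoints) \<le> a"
    using fixed by (simp only: fixpoints_def num_fixed_points_def)
  have "real (card two_cyclic) \<le> real (2 * num_cycles_of_length 2 n \<eta>)"
    using card_two_cyclic_le unfolding num_cycles_of_length_def by (rule of_nat_mono)
  with two have T: "real (card two_cyclic) \<le> 2 * b" by simp
  have "\<bar>measure_pmf.prob P B - measure_pmf.prob (poisson_pmf 1) B\<bar> \<le> K / n" for B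
  proof (cases "n \<ge> 4")
    case True
    have "(real (card fixpoints))\<^sup>2 \<le> a\<^sup>2" using F by (intro power_mono) auto
    then have "148 + 20 * real (card fixpoints) + 2 * (real (card fixpoints))\<^sup>2 +
        24 * real (card two_cyclic) \<le> K"
      unfolding K_def using F T by linarith
    then show ?thesis
      using prob_commuting_poisson_le[of B] True unfolding P
      by (auto elim!: order_trans intro: divide_right_mono)
  next
    \<comment> \<open>For n < 4 the trivial bound 1 suffices, as \<open>K\<close> is at least
      148.\<close>
    case False
    have "\<bar>measure_pmf.prob P B - measure_pmf.prob (poisson_pmf 1) B\<bar> \<le> 1"
      using measure_pmf.prob_le_1[of P B] measure_pmf.prob_le_1[of "poisson_pmf 1" B]
        measure_nonneg[of P B] measure_nonneg[of "poisson_pmf 1" B] by linarith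
    also have "1 \<le> K / n"
    proof -
      have "real n \<le> 4" using False by simp
      then have "real n \<le> K" using assms zero_le_power2[of a] unfolding K_def by linarith
      then show ?thesis using n by simp
    qed
    finally show ?thesis .
  qed
  then have "tv_dist P (poisson_pmf 1) \<le> K / n"
    unfolding tv_dist_def by (intro cSUP_least) auto
  then show "tv_dist (map_pmf (\<lambda>\<pi>. num_fixed_points n (commutator \<eta> \<pi>)) (pmf_of_set (sym_perms n)))
      (poisson_pmf 1) \<le> (148 + 20 * a + 2 * a\<^sup>2 + 48 * b) / real n"
    by (simp add: P_def K_def)
qed

end
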